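(* Let $X$ be a Banach space, $x_0\in X$, $R>0$, and let $A: B[x_0,R]\to X$ be an operator which satisfies the variable Lipschitz condition in the ball $B[x_0,R]$ with a nonnegative function $k(\cdot)$ on $[0,R]$. Suppose that the majorant functions $a_+(\cdot)$ and $a_-(\cdot)$ of $A$ have fixed points in the interval $[0,R]$, and let $x^*$ be the unique fixed point of $A$ in $L[x_0,r_*,r^*]$. Then: 1) for every initial approximation $\xi_0\in B[x_0,r^*]\cup L(x_0,r^*,r^{**})$ the successive approximations $\xi_{n+1}=A\xi_n$ $(n=0,1,\dots)$ are defined for all $n$ and converge to $x^*$; 2) the following estimates hold: $$\|x^*-\xi_n\|\le r^*+\rho_n-2r_n\qquad(n=0,1,\dots),$$ $$\|\xi_{n+1}-\xi_n\|\le\rho_{n+1}+\rho_n-2r_n\qquad(n=0,1,\dots),$$ where $r_0=0$, $r_{n+1}=a_+(r_n)$ and $\rho_0=\|\xi_0-x_0\|$, $\rho_{n+1}=a_+(\rho_n)$ for $n=0,1,\dots$.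
   Context: Notation: $B[x_0,r]=\{x\in X:\|x-x_0\|\le r\}$ is the closed ball. A fixed point of $A$ is a point $x\in B[x_0,R]$ with $Ax=x$. Variable Lipschitz condition: $A$ satisfies the variable Lipschitz condition in $B[x_0,R]$ with a nonnegative function $k(\cdot)$ on $[0,R]$ if, for every $r$ with $0<r\le R$ and all $x_1,x_2$ with $\|x_1-x_0\|\le r$, $\|x_2-x_0\|\le r$, one has $\|Ax_1-Ax_2\|\le k(r)\|x_1-x_2\|$. The function $k$ is assumed to be integrable on $[0,R]$, so that the integrals below make sense. Majorant functions: for $r\in[0,R]$, $a_\pm(r)=a\pm\int_0^r k(t)\,dt$, where $a=\|Ax_0-x_0\|$. $r^*$ denotes the smallest fixed point of $a_+$ in $[0,R]$, and $r_*$ denotes the smallest fixed point of $a_-$ in $[0,R]$. $r^{**}=\sup\{r:\ r^*<r\le R,\ a_+(r)<r\}$ provided that this set is nonempty; if the set is empty, put $r^{**}=r^*$ (so $L(x_0,r^*,r^{**})=\varnothing$). $L(x_0,r^*,r^{**})=\{x: r^*<\|x-x_0\|<r^{**}\}$ if $a_+(R)\ge R$, and $L(x_0,r^*,r^{**})=\{x: r^*<\|x-x_0\|\le r^{**}\}$ if $a_+(R)<R$. $L[x_0,r_*,r^*]=\{x:\ r_*\le\|x-x_0\|\le r^*\}$. Under the stated hypotheses on $A$, $a_+$, $a_-$, the operator $A$ has exactly one fixed point in $L[x_0,r_*,r^*]$ (a separate theorem of the paper); this is the point denoted $x^*$. *)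

theory Defs
  imports "HOL-Analysis.Analysis"
begin

text \<open>
  An operator on the closed ball around \<open>x0\<close> with radius \<open>R\<close> is represented by a total function
  \<open>A\<close>; its values outside that ball are never constrained. Functions on the interval from \<open>0\<close> to
  \<open>R\<close> are likewise represented by total functions on the reals.
\<close>

definition variable_lipschitz ::
    "('a::real_normed_vector \<Rightarrow> 'a) \<Rightarrow> 'a \<Rightarrow> real \<Rightarrow> (real \<Rightarrow> real) \<Rightarrow> bool" where
  "variable_lipschitz A x0 R k \<longleftrightarrow>
     (\<forall>r\<in>{0<..R}. \<forall>x1\<in>cball x0 r. \<forall>x2\<in>cball x0 r.
        norm (A x1 - A x2) \<le> k r * norm (x1 - x2))"

text \<open>
  The integral is the Henstock--Kurzweil one. It is only used for \<open>k\<close> nonnegative on the interval,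
  where integrability and the value agree with those of the Lebesgue integral.
\<close>

definition a_plus ::
    "('a::real_normed_vector \<Rightarrow> 'a) \<Rightarrow> 'a \<Rightarrow> (real \<Rightarrow> real) \<Rightarrow> real \<Rightarrow> real" where
  "a_plus A x0 k r = norm (A x0 - x0) + integral {0..r} k"

definition a_minus ::
    "('a::real_normed_vector \<Rightarrow> 'a) \<Rightarrow> 'a \<Rightarrow> (real \<Rightarrow> real) \<Rightarrow> real \<Rightarrow> real" where
  "a_minus A x0 k r = norm (A x0 - x0) - integral {0..r} k"

definition smallest_fixpoint :: "real \<Rightarrow> (real \<Rightarrow> real) \<Rightarrow> real" where
  "smallest_fixpoint R f = (LEAST r. r \<in> {0..R} \<and> f r = r)"

text \<open>
  \<open>r_upper\<close>, \<open>r_lower\<close> and \<open>r_outer\<close> stand for $r^*$, $r_*$ and $r^{**}$, respectively.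
\<close>

definition r_upper ::
    "('a::real_normed_vector \<Rightarrow> 'a) \<Rightarrow> 'a \<Rightarrow> real \<Rightarrow> (real \<Rightarrow> real) \<Rightarrow> real" where
  "r_upper A x0 R k = smallest_fixpoint R (a_plus A x0 k)"

definition r_lower ::
    "('a::real_normed_vector \<Rightarrow> 'a) \<Rightarrow> 'a \<Rightarrow> real \<Rightarrow> (real \<Rightarrow> real) \<Rightarrow> real" where
  "r_lower A x0 R k = smallest_fixpoint R (a_minus A x0 k)"

definition r_outer ::
    "('a::real_normed_vector \<Rightarrow> 'a) \<Rightarrow> 'a \<Rightarrow> real \<Rightarrow> (real \<Rightarrow> real) \<Rightarrow> real" where
  "r_outer A x0 R k =
     (let S = {r. r_upper A x0 R k < r \<and> r \<le> R \<and> a_plus A x0 k r < r}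
      in if S = {} then r_upper A x0 R k else Sup S)"

text \<open>The layer $L(x_0,r^*,r^{**})$.\<close>

definition outer_layer ::
    "('a::real_normed_vector \<Rightarrow> 'a) \<Rightarrow> 'a \<Rightarrow> real \<Rightarrow> (real \<Rightarrow> real) \<Rightarrow> 'a set" where
  "outer_layer A x0 R k =
     (if a_plus A x0 k R < R
      then {x. r_upper A x0 R k < norm (x - x0) \<and> norm (x - x0) \<le> r_outer A x0 R k}
      else {x. r_upper A x0 R k < norm (x - x0) \<and> norm (x - x0) < r_outer A x0 R k})"

text \<open>The layer $L[x_0,r_*,r^*]$.\<close>

definition inner_layer ::
    "('a::real_normed_vector \<Rightarrow> 'a) \<Rightarrow> 'a \<Rightarrow> real \<Rightarrow> (real \<Rightarrow> real) \<Rightarrow> 'a set" where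
  "inner_layer A x0 R k =
     {x. r_lower A x0 R k \<le> norm (x - x0) \<and> norm (x - x0) \<le> r_upper A x0 R k}"

text \<open>The point $x^*$.\<close>

definition layer_fixpoint ::
    "('a::real_normed_vector \<Rightarrow> 'a) \<Rightarrow> 'a \<Rightarrow> real \<Rightarrow> (real \<Rightarrow> real) \<Rightarrow> 'a" where
  "layer_fixpoint A x0 R k = (THE x. x \<in> inner_layer A x0 R k \<and> A x = x)"

end

theory Submission
  imports Defs
begin

text \<open>
  Write $a_+$ for the majorant and \<open>rs\<close> for its smallest fixed point. Everything rests on
  \<open>integral_lipschitz\<close>, which sharpens the Lipschitz condition along a segment: as a point moves
  from the ball of radius $p$ to the ball of radius $q$, the relevant Lipschitz constant is the
  average of $k$ over $[p,q]$ and not its value at $q$. It is used in two ways.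

  If the distance of the two points is at most $q - p$, the estimate says that $A$ increases the
  distance to at most $a_+(q) - a_+(p)$. Iterating this (\<open>orbit_compare\<close>) compares two orbits of
  $A$ with two orbits of $a_+$. Applied to the orbit of $x_0$ and its own shifts, it makes the orbit
  of $x_0$ Cauchy, since the orbit of $0$ under $a_+$ increases to \<open>rs\<close>; the limit is a fixed
  point of $A$. Applied to the orbit of $x_0$ and any other orbit $(\xi_n)$, it bounds their distance
  by $\rho_n - r_n$, and both error estimates of the theorem are triangle inequalities through the
  orbit of $x_0$. For a start in the ball of radius \<open>rs\<close> the sequence $\rho_n$ is squeezed
  between $r_n$ and \<open>rs\<close>, so the two orbits merge. This gives convergence, and also uniqueness of
  the fixed point in that ball. That the fixed point lies outside the open ball of radius $r_*$
  is the same comparison read backwards, as $a_-(d) \le d$ forces $d \ge r_*$.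

  For a start in the outer layer this squeeze is not available: $k$ need not be monotone, so $a_+$
  may have fixed points other than \<open>rs\<close> below the starting radius, at which $\rho_n$ may get
  stuck. But the starting point lies in a ball of some radius $s >$ \<open>rs\<close> with $a_+(s) < s$. The
  fixed point lies in the ball of radius \<open>rs\<close>, and the average of $k$ over the interval from
  \<open>rs\<close> to $s$ is below $1$. Hence \<open>integral_lipschitz\<close>, used with $p =$ \<open>rs\<close> and $q = s$,
  shows that $A$ contracts distances to the fixed point by a fixed factor on the ball of radius $s$
  (\<open>contraction_towards_fixpoint\<close>).
\<close>

section \<open>Smallest fixed points on an interval\<close>

lemma smallest_fixpoint_attained:
  assumes cont: "continuous_on {0..R} f" and ex: "\<exists>t\<in>{0..R}. f t = t"
  shows "smallest_fixpoint R f \<in> {0..R}" "f (smallest_fixpoint R f) = smallest_fixpoint R f"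
    and "\<And>t. t \<in> {0..R} \<Longrightarrow> f t = t \<Longrightarrow> smallest_fixpoint R f \<le> t"
proof -
  define F where "F = {t \<in> {0..R}. f t = t}"
  have "closed {t \<in> {0..R}. f t - t = 0}"
    by (intro continuous_closed_preimage_constant continuous_intros cont closed_atLeastAtMost)
  then have "closed F" by (simp add: F_def)
  then have "compact ({0..R} \<inter> F)" by (intro compact_Int_closed compact_Icc)
  moreover have "{0..R} \<inter> F = F" by (auto simp: F_def)
  ultimately have "compact F" by simp
  moreover have "F \<noteq> {}" using ex by (auto simp: F_def)
  ultimately obtain m where m: "m \<in> F" "\<And>t. t \<in> F \<Longrightarrow> m \<le> t"
    by (meson compact_attains_inf)
  then have "smallest_fixpoint R f = m"
    unfolding smallest_fixpoint_def by (intro Least_equality) (auto simp: F_def)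
  with m show "smallest_fixpoint R f \<in> {0..R}" "f (smallest_fixpoint R f) = smallest_fixpoint R f"
    "\<And>t. t \<in> {0..R} \<Longrightarrow> f t = t \<Longrightarrow> smallest_fixpoint R f \<le> t"
    by (auto simp: F_def)
qed

section \<open>The integral Lipschitz estimate\<close>

locale variable_lipschitz_operator =
  fixes A :: "'a::banach \<Rightarrow> 'a" and x0 :: 'a and R :: real and k :: "real \<Rightarrow> real"
  assumes R_pos: "R > 0"
    and k_nonneg: "\<And>t. t \<in> {0..R} \<Longrightarrow> k t \<ge> 0"
    and k_integrable: "k integrable_on {0..R}"
    and lipschitz: "variable_lipschitz A x0 R k"
begin

abbreviation a_p :: "real \<Rightarrow> real" where "a_p \<equiv> a_plus A x0 k"

lemma k_integrable_sub: "0 \<le> p \<Longrightarrow> q \<le> R \<Longrightarrow> k integrable_on {p..q}"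
  using integrable_on_subinterval[OF k_integrable] by auto

lemma integral_k_nonneg: "0 \<le> p \<Longrightarrow> q \<le> R \<Longrightarrow> 0 \<le> integral {p..q} k"
  using k_integrable_sub k_nonneg by (intro integral_nonneg) auto

lemma integral_k_split:
  assumes "0 \<le> p" "p \<le> q" "q \<le> s" "s \<le> R"
  shows "integral {p..q} k + integral {q..s} k = integral {p..s} k"
  using assms by (intro Henstock_Kurzweil_Integration.integral_combine k_integrable_sub) auto

lemma lipschitz_on_ball:
  assumes "0 < t" "t \<le> R" "x \<in> cball x0 t" "y \<in> cball x0 t"
  shows "norm (A y - A x) \<le> k t * norm (y - x)"
  using lipschitz assms unfolding variable_lipschitz_def by auto

text \<open>
  On the ball of radius $t$ every $k(s)$ with $s \ge t$ is a Lipschitz constant, so the mean of $k$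
  over any interval starting at $t$ is one as well. Point values
  of $k$ say nothing about its integral; this estimate trades them for integrals.
\<close>

lemma lipschitz_average:
  assumes "0 < t" "t \<le> u" "u \<le> R" "x \<in> cball x0 t" "y \<in> cball x0 t"
  shows "(u - t) * norm (A y - A x) \<le> norm (y - x) * integral {t..u} k"
proof -
  have "integral {t..u} (\<lambda>_. norm (A y - A x)) \<le> integral {t..u} (\<lambda>s. norm (y - x) * k s)"
  proof (rule integral_le)
    show "(\<lambda>s. norm (y - x) * k s) integrable_on {t..u}"
      using integrable_cmul[OF k_integrable_sub[of t u], of "norm (y - x)"] assms by simp
    fix s assume "s \<in> {t..u}"
    then show "norm (A y - A x) \<le> norm (y - x) * k s"
      using lipschitz_on_ball[of s x y] assms by (auto simp: mult.commute)
  qed auto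
  then show ?thesis using assms by simp
qed

text \<open>
  Cut the segment from $x$ to $y$, and the interval $[p,q]$ along with it, into equal cells. Both
  ends of the cell number $i$ lie in the ball whose radius is the right end of the interval cell, so
  \<open>lipschitz_average\<close> bounds the increment of $A$ by the integral of $k$ over the \<^emph>\<open>next\<close> cell.
  The last cell has no successor; its increment is bounded by means of $k(q)$, and this error
  vanishes as the cells shrink.
\<close>

lemma integral_lipschitz:
  assumes pq: "0 \<le> p" "p < q" "q \<le> R" and x: "x \<in> cball x0 p" and y: "y \<in> cball x0 q"
  shows "norm (A y - A x) * (q - p) \<le> norm (y - x) * integral {p..q} k"
proof -
  have approx: "norm (A y - A x) * (q - p)
      \<le> norm (y - x) * integral {p..q} k + norm (y - x) * k q * (q - p) * inverse (real (Suc m))"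
    for m
  proof -
    define N where "N = real (Suc m)"
    define h where "h = (q - p) / N"
    define \<delta> where "\<delta> = norm (y - x) / N"
    define z where "z i = x + (real i / N) *\<^sub>R (y - x)" for i
    define t where "t i = p + real i * h" for i
    have N: "N > 0" by (simp add: N_def)
    have h: "h > 0" using N pq by (simp add: h_def)
    have \<delta>: "\<delta> \<ge> 0" using N by (simp add: \<delta>_def)
    have z0: "z 0 = x" by (simp add: z_def)
    have zN: "z (Suc m) = y" using N by (simp add: z_def N_def)
    have tN: "t (Suc m) = q" using N by (simp add: t_def h_def N_def)
    have t_mono: "t i \<le> t j" if "i \<le> j" for i j
      using that h by (simp add: t_def mult_right_mono)
    have t_Suc: "t (Suc i) = t i + h" for i by (simp add: t_def algebra_simps)
    have t_ge: "p \<le> t i" for i using h by (simp add: t_def)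
    have t_le: "t i \<le> q" if "i \<le> Suc m" for i using t_mono[OF that] tN by simp
    have z_step: "norm (z (Suc i) - z i) = \<delta>" for i
    proof -
      have "z (Suc i) - z i = (1 / N) *\<^sub>R (y - x)"
        by (simp add: z_def add_divide_distrib flip: scaleR_left_diff_distrib)
      then show ?thesis using N by (simp add: \<delta>_def)
    qed
    have z_ball: "z i \<in> cball x0 (t i)" if "i \<le> Suc m" for i
    proof -
      define u where "u = real i / N"
      have u: "0 \<le> u" "u \<le> 1" using that N by (auto simp: u_def N_def)
      have "z i - x0 = (1 - u) *\<^sub>R (x - x0) + u *\<^sub>R (y - x0)"
        by (simp add: z_def u_def algebra_simps)
      then have "norm (z i - x0) \<le> (1 - u) * norm (x - x0) + u * norm (y - x0)"
        using u norm_triangle_ineq[of "(1 - u) *\<^sub>R (x - x0)" "u *\<^sub>R (y - x0)"] by simp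
      also have "\<dots> \<le> (1 - u) * p + u * q"
        using u x y by (intro add_mono mult_left_mono) (auto simp: dist_norm norm_minus_commute)
      also have "\<dots> = t i" by (simp add: t_def u_def h_def algebra_simps diff_divide_distrib)
      finally show ?thesis by (simp add: dist_norm norm_minus_commute)
    qed
    have z_ball': "z i \<in> cball x0 (t (Suc i))" if "i \<le> Suc m" for i
      using z_ball[OF that] t_mono[of i "Suc i"] by auto
    \<comment> \<open>The integral starts at \<open>t 1\<close> because each increment is charged to the following cell.\<close>
    have telescope: "h * norm (A (z n) - A x) \<le> \<delta> * integral {t 1..t (Suc n)} k" if "n \<le> m" for n
      using that
    proof (induction n)
      case 0 show ?case by (simp add: z0)
    next
      case (Suc n)
      have "h * norm (A (z (Suc n)) - A (z n)) \<le> \<delta> * integral {t (Suc n)..t (Suc (Suc n))} k"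
        using lipschitz_average[of "t (Suc n)" "t (Suc (Suc n))" "z n" "z (Suc n)"]
          z_ball'[of n] z_ball[of "Suc n"] Suc.prems t_le[of "Suc (Suc n)"] pq h t_ge[of n]
        by (simp add: t_Suc z_step)
      moreover have combine: "integral {t 1..t (Suc n)} k + integral {t (Suc n)..t (Suc (Suc n))} k
          = integral {t 1..t (Suc (Suc n))} k"
        using t_mono[of 1 "Suc n"] t_mono[of "Suc n" "Suc (Suc n)"] t_ge[of 1] pq Suc.prems
          t_le[of "Suc (Suc n)"] by (intro integral_k_split) auto
      moreover have "norm (A (z (Suc n)) - A x) \<le> norm (A (z (Suc n)) - A (z n)) + norm (A (z n) - A x)"
        using norm_triangle_ineq[of "A (z (Suc n)) - A (z n)" "A (z n) - A x"] by simp
      then have "h * norm (A (z (Suc n)) - A x)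
          \<le> h * norm (A (z (Suc n)) - A (z n)) + h * norm (A (z n) - A x)"
        using h by (simp flip: distrib_left)
      moreover have "h * norm (A (z n) - A x) \<le> \<delta> * integral {t 1..t (Suc n)} k"
        using Suc by simp
      ultimately have "h * norm (A (z (Suc n)) - A x)
          \<le> \<delta> * integral {t 1..t (Suc n)} k + \<delta> * integral {t (Suc n)..t (Suc (Suc n))} k"
        by linarith
      also have "\<dots> = \<delta> * integral {t 1..t (Suc (Suc n))} k"
        unfolding distrib_left[symmetric] combine ..
      finally show ?case .
    qed
    have last: "norm (A y - A (z m)) \<le> k q * \<delta>"
      using lipschitz_on_ball[of q "z m" y] z_ball'[of m] y pq z_step[of m] zN tN by simp
    have "integral {t 1..q} k \<le> integral {p..q} k"
      using integral_k_split[of p "t 1" q] integral_k_nonneg[of p "t 1"] t_ge[of 1] t_le[of 1] pq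
      by simp
    then have first: "h * norm (A (z m) - A x) \<le> \<delta> * integral {p..q} k"
      using telescope[of m] tN \<delta> mult_left_mono order_trans by fastforce
    have "norm (A y - A x) \<le> norm (A y - A (z m)) + norm (A (z m) - A x)"
      using norm_triangle_ineq[of "A y - A (z m)" "A (z m) - A x"] by simp
    then have "h * norm (A y - A x) \<le> h * norm (A y - A (z m)) + h * norm (A (z m) - A x)"
      using h by (simp flip: distrib_left)
    also have "\<dots> \<le> h * (k q * \<delta>) + \<delta> * integral {p..q} k"
      using h last first by (intro add_mono mult_left_mono) auto
    finally have "N * (h * norm (A y - A x)) \<le> N * (h * (k q * \<delta>) + \<delta> * integral {p..q} k)"
      using N by simp
    moreover have Nh: "q - p = N * h" and N\<delta>: "norm (y - x) = N * \<delta>"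
      using N by (auto simp: h_def \<delta>_def)
    have "N * (h * norm (A y - A x)) = norm (A y - A x) * (q - p)"
      unfolding Nh by (simp add: mult_ac)
    moreover have "N * (h * (k q * \<delta>) + \<delta> * integral {p..q} k) =
         norm (y - x) * integral {p..q} k + norm (y - x) * k q * h"
      unfolding N\<delta> by (simp add: algebra_simps)
    moreover have "norm (y - x) * k q * h = norm (y - x) * k q * (q - p) * inverse (real (Suc m))"
      by (simp add: h_def N_def field_simps)
    ultimately show ?thesis by simp
  qed
  have "(\<lambda>m. norm (y - x) * integral {p..q} k + norm (y - x) * k q * (q - p) * inverse (real (Suc m)))
      \<longlonglongrightarrow> norm (y - x) * integral {p..q} k + norm (y - x) * k q * (q - p) * 0"
    by (intro tendsto_intros LIMSEQ_inverse_real_of_nat)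
  then show ?thesis using approx by (intro LIMSEQ_le_const) auto
qed

section \<open>Comparison of orbits with the majorant iteration\<close>

lemma a_plus_diff:
  assumes "0 \<le> p" "p \<le> q" "q \<le> R"
  shows "a_p q - a_p p = integral {p..q} k"
  using integral_k_split[of 0 p q] assms by (simp add: a_plus_def)

lemma a_plus_mono: "0 \<le> p \<Longrightarrow> p \<le> q \<Longrightarrow> q \<le> R \<Longrightarrow> a_p p \<le> a_p q"
  using a_plus_diff[of p q] integral_k_nonneg[of p q] by simp

lemma a_plus_nonneg: "0 \<le> p \<Longrightarrow> p \<le> R \<Longrightarrow> 0 \<le> a_p p"
  using integral_k_nonneg[of 0 p] by (simp add: a_plus_def)

lemma a_plus_continuous: "continuous_on {0..R} a_p"
  unfolding a_plus_def by (intro continuous_intros indefinite_integral_continuous_1 k_integrable)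

lemma a_minus_continuous: "continuous_on {0..R} (a_minus A x0 k)"
  unfolding a_minus_def by (intro continuous_intros indefinite_integral_continuous_1 k_integrable)

lemma majorant_step:
  assumes "0 \<le> p" "q \<le> R" "x \<in> cball x0 p" "norm (y - x) \<le> q - p"
  shows "norm (A y - A x) \<le> a_p q - a_p p"
proof (cases "p = q")
  case True
  then show ?thesis using assms by simp
next
  case False
  then have "p < q" using assms by (smt (verit) norm_ge_zero)
  have y: "y \<in> cball x0 q"
    using assms norm_triangle_ineq[of "y - x" "x - x0"] by (auto simp: dist_norm norm_minus_commute)
  have "norm (A y - A x) * (q - p) \<le> norm (y - x) * integral {p..q} k"
    using integral_lipschitz \<open>p < q\<close> assms y by blast
  also have "\<dots> \<le> (q - p) * integral {p..q} k"
    using assms integral_k_nonneg by (intro mult_right_mono) auto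
  finally show ?thesis using \<open>p < q\<close> assms by (simp add: a_plus_diff mult.commute)
qed

lemma majorant_bound:
  assumes "p \<le> R" "x \<in> cball x0 p"
  shows "A x \<in> cball x0 (a_p p)"
proof -
  have "norm (A x - A x0) \<le> a_p p - a_p 0"
    using majorant_step[of 0 p x0 x] assms by (simp add: dist_norm norm_minus_commute)
  then show ?thesis
    using norm_triangle_ineq[of "A x - A x0" "A x0 - x0"]
    by (simp add: a_plus_def dist_norm norm_minus_commute)
qed

text \<open>
  The orbits below are only controlled while the majorant iterates stay in $[0,R]$; a radius
  $M$ with $a_+(M) \le M$ guarantees this for all starting radii up to $M$.
\<close>

lemma majorant_invariant:
  assumes "0 \<le> p" "p \<le> M" "M \<le> R" "a_p M \<le> M"
  shows "(a_p ^^ n) p \<in> {0..M}"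
proof (induction n)
  case (Suc n)
  then show ?case using a_plus_mono[of "(a_p ^^ n) p" M] a_plus_nonneg[of "(a_p ^^ n) p"] assms by auto
qed (use assms in auto)

lemma orbit_bound:
  assumes "0 \<le> p" "p \<le> M" "M \<le> R" "a_p M \<le> M" "x \<in> cball x0 p"
  shows "(A ^^ n) x \<in> cball x0 ((a_p ^^ n) p)"
proof (induction n)
  case (Suc n)
  have "(a_p ^^ n) p \<le> R" using majorant_invariant[of p M n] assms by auto
  then show ?case using majorant_bound Suc by simp
qed (use assms in auto)

lemma orbit_compare:
  assumes "0 \<le> p" "q \<le> M" "M \<le> R" "a_p M \<le> M"
    and "x \<in> cball x0 p" "norm (y - x) \<le> q - p"
  shows "norm ((A ^^ n) y - (A ^^ n) x) \<le> (a_p ^^ n) q - (a_p ^^ n) p"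
proof (induction n)
  case (Suc n)
  have "p \<le> q" using assms by (smt (verit) norm_ge_zero)
  then have "(a_p ^^ n) q \<le> R" "0 \<le> (a_p ^^ n) p" "(A ^^ n) x \<in> cball x0 ((a_p ^^ n) p)"
    using majorant_invariant[of q M n] majorant_invariant[of p M n] orbit_bound[of p M x n] assms
    by auto
  then show ?case using majorant_step Suc by simp
qed (use assms in auto)

end

section \<open>The fixed point and the convergence of all orbits\<close>

locale majorized_operator = variable_lipschitz_operator +
  assumes a_plus_fixpoint: "\<exists>t\<in>{0..R}. a_plus A x0 k t = t"
    and a_minus_fixpoint: "\<exists>t\<in>{0..R}. a_minus A x0 k t = t"
begin

abbreviation rs :: real where "rs \<equiv> r_upper A x0 R k"

lemma rs_range: "0 \<le> rs" "rs \<le> R" and rs_fixpoint: "a_p rs = rs"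
  and rs_least: "\<And>t. t \<in> {0..R} \<Longrightarrow> a_p t = t \<Longrightarrow> rs \<le> t"
  using smallest_fixpoint_attained[OF a_plus_continuous a_plus_fixpoint]
  unfolding r_upper_def by auto

lemma majorant_iterates_below: "(a_p ^^ n) 0 \<in> {0..rs}"
  using majorant_invariant[of 0 rs] rs_range rs_fixpoint by simp

text \<open>
  The iterates increase from $0$ and cannot pass \<open>rs\<close>; by continuity their limit is a fixed
  point, and no fixed point lies below \<open>rs\<close>.
\<close>

lemma majorant_iterates_tendsto: "(\<lambda>n. (a_p ^^ n) 0) \<longlonglongrightarrow> rs"
proof -
  let ?r = "\<lambda>n. (a_p ^^ n) 0"
  have in_range: "?r n \<in> {0..R}" for n using majorant_iterates_below[of n] rs_range by auto
  have "?r n \<le> ?r (Suc n)" for n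
  proof (induction n)
    case 0 show ?case using a_plus_nonneg[of 0] R_pos by simp
  next
    case (Suc n)
    then show ?case using a_plus_mono[of "?r n" "?r (Suc n)"] in_range[of n] in_range[of "Suc n"] by simp
  qed
  then have "incseq ?r" by (intro incseq_SucI)
  moreover have "\<forall>n. ?r n \<le> rs" using majorant_iterates_below by simp
  ultimately obtain l where l: "?r \<longlonglongrightarrow> l" by (rule incseq_convergent)
  have l_range: "l \<in> {0..rs}"
    using closed_sequentially[OF closed_atLeastAtMost _ l] majorant_iterates_below by blast
  have "(\<lambda>n. a_p (?r n)) \<longlonglongrightarrow> a_p l"
    using a_plus_continuous l l_range rs_range in_range
    by (intro continuous_on_tendsto_compose[OF a_plus_continuous]) auto
  moreover have "(\<lambda>n. a_p (?r n)) \<longlonglongrightarrow> l" using LIMSEQ_Suc[OF l] by simp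
  ultimately have "a_p l = l" by (rule LIMSEQ_unique)
  then have "rs \<le> l" using rs_least l_range rs_range by auto
  then show ?thesis using l l_range by auto
qed

lemma base_orbit_in_ball: "(A ^^ n) x0 \<in> cball x0 ((a_p ^^ n) 0)"
  using orbit_bound[of 0 rs x0 n] rs_range rs_fixpoint by simp

text \<open>
  The orbit of $x_0$ shifted by $j$ is the orbit of $A^j x_0$, a point at distance at most
  $a_+^j(0)$ from $x_0$, so that the comparison of orbits applies to it.
\<close>

lemma base_orbit_increment:
  "norm ((A ^^ (n + j)) x0 - (A ^^ n) x0) \<le> (a_p ^^ (n + j)) 0 - (a_p ^^ n) 0"
  using orbit_compare[of 0 "(a_p ^^ j) 0" rs x0 "(A ^^ j) x0" n] base_orbit_in_ball[of j]
    majorant_iterates_below[of j] rs_range rs_fixpoint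
  by (simp add: funpow_add dist_norm norm_minus_commute)

lemma compare_with_base_orbit:
  assumes "norm (x - x0) \<le> M" "M \<le> R" "a_p M \<le> M"
  shows "norm ((A ^^ n) x - (A ^^ n) x0) \<le> (a_p ^^ n) (norm (x - x0)) - (a_p ^^ n) 0"
  using orbit_compare[of 0 "norm (x - x0)" M x0 x n] assms by simp

lemma base_orbit_limit:
  obtains x where "(\<lambda>n. (A ^^ n) x0) \<longlonglongrightarrow> x" "A x = x" "x \<in> cball x0 rs"
    and "\<And>n. norm (x - (A ^^ n) x0) \<le> rs - (a_p ^^ n) 0"
proof -
  let ?x = "\<lambda>n. (A ^^ n) x0"
  have tail: "norm (?x (n + j) - ?x n) \<le> rs - (a_p ^^ n) 0" for n j
    using base_orbit_increment[of n j] majorant_iterates_below[of "n + j"] by auto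
  have "Cauchy ?x"
  proof (rule metric_CauchyI)
    fix e :: real assume "e > 0"
    then have "\<forall>\<^sub>F n in sequentially. rs - e / 2 < (a_p ^^ n) 0"
      by (intro order_tendstoD(1)[OF majorant_iterates_tendsto]) simp
    then obtain N where "rs - e / 2 < (a_p ^^ N) 0" by (auto simp: eventually_sequentially)
    then have N: "rs - (a_p ^^ N) 0 < e / 2" by simp
    have near: "dist (?x m) (?x N) < e / 2" if "m \<ge> N" for m
      using tail[of N "m - N"] N that by (simp add: dist_norm)
    show "\<exists>N. \<forall>m\<ge>N. \<forall>n\<ge>N. dist (?x m) (?x n) < e"
      using near dist_triangle_half_l by blast
  qed
  then obtain x where x: "?x \<longlonglongrightarrow> x" using Cauchy_convergent convergent_def by blast
  have dist_le: "norm (x - ?x n) \<le> rs - (a_p ^^ n) 0" for n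
  proof (rule LIMSEQ_le_const2)
    show "(\<lambda>j. norm (?x (j + n) - ?x n)) \<longlonglongrightarrow> norm (x - ?x n)"
      using LIMSEQ_ignore_initial_segment[OF x, of n] by (intro tendsto_intros)
    show "\<exists>N. \<forall>j\<ge>N. norm (?x (j + n) - ?x n) \<le> rs - (a_p ^^ n) 0"
      using tail[of n] by (auto simp: add.commute)
  qed
  have x_ball: "x \<in> cball x0 rs" using dist_le[of 0] by (simp add: dist_norm norm_minus_commute)
  have "?x n \<in> cball x0 R" for n
    using base_orbit_in_ball[of n] majorant_iterates_below[of n] rs_range by auto
  then have "norm (A (?x n) - A x) \<le> k R * norm (?x n - x)" for n
    using lipschitz_on_ball[of R x "?x n"] R_pos x_ball rs_range by auto
  moreover have "(\<lambda>n. k R * norm (?x n - x)) \<longlonglongrightarrow> 0"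
    using x tendsto_mult_right_zero tendsto_norm_zero_iff LIM_zero by metis
  ultimately have "(\<lambda>n. A (?x n) - A x) \<longlonglongrightarrow> 0"
    by (intro Lim_null_comparison[of "\<lambda>n. A (?x n) - A x"]) auto
  then have "(\<lambda>n. ?x (Suc n)) \<longlonglongrightarrow> A x" by (simp add: LIM_zero_iff)
  then have "A x = x" using LIMSEQ_Suc[OF x] LIMSEQ_unique by blast
  with x x_ball dist_le that show ?thesis by blast
qed

text \<open>
  The difference is at most the gap between the majorant orbits of $\|x - x_0\|$ and $0$, both of
  which stay below \<open>rs\<close> while the second one tends to it.
\<close>

lemma orbits_merge_in_inner_ball:
  assumes "x \<in> cball x0 rs"
  shows "(\<lambda>n. (A ^^ n) x - (A ^^ n) x0) \<longlonglongrightarrow> 0"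
proof (rule Lim_null_comparison)
  have le: "norm (x - x0) \<le> rs" using assms by (simp add: dist_norm norm_minus_commute)
  have "(a_p ^^ n) (norm (x - x0)) \<le> rs" for n
    using majorant_invariant[of "norm (x - x0)" rs n] le rs_range rs_fixpoint by auto
  then show "\<forall>\<^sub>F n in sequentially. norm ((A ^^ n) x - (A ^^ n) x0) \<le> rs - (a_p ^^ n) 0"
    using compare_with_base_orbit[OF le] rs_range rs_fixpoint
    by (intro always_eventually allI) (smt (verit))
  show "(\<lambda>n. rs - (a_p ^^ n) 0) \<longlonglongrightarrow> 0"
    using tendsto_diff[OF tendsto_const majorant_iterates_tendsto, of rs] by simp
qed

text \<open>
  A fixed point at distance $d$ satisfies $\|A x_0 - x_0\| \le d + \int_0^d k$, that is
  $a_-(d) \le d$. As $a_-$ is nonincreasing, this fails for $d < r_*$.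
\<close>

lemma fixpoint_outside_lower_radius:
  assumes "A x = x" "x \<in> cball x0 R"
  shows "r_lower A x0 R k \<le> norm (x - x0)"
proof (rule ccontr)
  let ?l = "r_lower A x0 R k" and ?d = "norm (x - x0)"
  assume "\<not> ?l \<le> ?d"
  moreover have l: "?l \<in> {0..R}" "a_minus A x0 k ?l = ?l"
    using smallest_fixpoint_attained[OF a_minus_continuous a_minus_fixpoint]
    unfolding r_lower_def by auto
  moreover have "norm (A x0 - x0) \<le> ?d + integral {0..?d} k"
  proof -
    have "norm (A x - A x0) \<le> integral {0..?d} k"
      using majorant_step[of 0 ?d x0 x] assms by (simp add: a_plus_def dist_norm norm_minus_commute)
    moreover have "norm (A x0 - x0) \<le> norm (x - x0) + norm (x - A x0)"
      using norm_triangle_ineq4[of "x - x0" "x - A x0"] by simp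
    ultimately show ?thesis using assms by simp
  qed
  moreover have "integral {0..?d} k \<le> integral {0..?l} k"
    using a_plus_mono[of ?d ?l] l \<open>\<not> ?l \<le> ?d\<close> by (simp add: a_plus_def)
  ultimately show False by (simp add: a_minus_def)
qed

text \<open>
  The definite description denotes the limit of the orbit of $x_0$: a fixed point in the layer is
  its own orbit, which has to merge with the orbit of $x_0$.
\<close>

lemma layer_fixpoint_properties:
  defines "xs \<equiv> layer_fixpoint A x0 R k"
  shows layer_fixpoint_limit: "(\<lambda>n. (A ^^ n) x0) \<longlonglongrightarrow> xs"
    and layer_fixpoint_fixed: "A xs = xs"
    and layer_fixpoint_in_ball: "xs \<in> cball x0 rs"
    and layer_fixpoint_error: "norm (xs - (A ^^ n) x0) \<le> rs - (a_p ^^ n) 0"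
proof -
  obtain x where x: "(\<lambda>n. (A ^^ n) x0) \<longlonglongrightarrow> x" "A x = x" "x \<in> cball x0 rs"
    and err: "\<And>n. norm (x - (A ^^ n) x0) \<le> rs - (a_p ^^ n) 0"
    using base_orbit_limit by blast
  have "xs = x"
    unfolding xs_def layer_fixpoint_def
  proof (rule the_equality)
    show "x \<in> inner_layer A x0 R k \<and> A x = x"
      using x rs_range fixpoint_outside_lower_radius[of x]
      by (auto simp: inner_layer_def dist_norm norm_minus_commute)
  next
    fix y assume y: "y \<in> inner_layer A x0 R k \<and> A y = y"
    then have "(A ^^ n) y = y" for n by (induction n) auto
    then have "(\<lambda>n. y - (A ^^ n) x0) \<longlonglongrightarrow> 0"
      using orbits_merge_in_inner_ball[of y] y
      by (simp add: inner_layer_def dist_norm norm_minus_commute)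
    moreover have "(\<lambda>n. y - (A ^^ n) x0) \<longlonglongrightarrow> y - x" using x by (intro tendsto_intros)
    ultimately show "y = x" using LIMSEQ_unique by fastforce
  qed
  with x err show "(\<lambda>n. (A ^^ n) x0) \<longlonglongrightarrow> xs" "A xs = xs" "xs \<in> cball x0 rs"
    "norm (xs - (A ^^ n) x0) \<le> rs - (a_p ^^ n) 0" by auto
qed

text \<open>
  The two cases in the definition of the outer layer are what makes this true: the supremum $r^{**}$
  itself may serve as a starting radius when it is the endpoint $R$ and $a_+(R) < R$, and otherwise
  a start strictly below the supremum leaves room for some $s$.
\<close>

lemma outer_layer_radius:
  assumes "x \<in> outer_layer A x0 R k"
  obtains s where "rs < s" "s \<le> R" "a_p s < s" "norm (x - x0) \<le> s"
proof -
  define S where "S = {r. rs < r \<and> r \<le> R \<and> a_p r < r}"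
  have outer: "r_outer A x0 R k = (if S = {} then rs else Sup S)"
    unfolding r_outer_def S_def Let_def ..
  have bdd: "bdd_above S" by (auto simp: S_def intro: bdd_aboveI[of _ R])
  have "S \<noteq> {}" using assms outer by (auto simp: outer_layer_def split: if_splits)
  show ?thesis
  proof (cases "a_p R < R")
    case True
    then have "norm (x - x0) \<le> Sup S" using assms outer \<open>S \<noteq> {}\<close> by (simp add: outer_layer_def)
    also have "Sup S \<le> R" using \<open>S \<noteq> {}\<close> by (intro cSup_least) (auto simp: S_def)
    finally show ?thesis using True that[of R] rs_range rs_fixpoint by fastforce
  next
    case False
    then have "norm (x - x0) < Sup S" using assms outer \<open>S \<noteq> {}\<close> by (simp add: outer_layer_def)
    then obtain s where "s \<in> S" "norm (x - x0) < s"
      using less_cSup_iff[OF \<open>S \<noteq> {}\<close> bdd] by blast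
    then show ?thesis using that[of s] by (auto simp: S_def)
  qed
qed

text \<open>
  The factor $\theta$ is the mean of $k$ over the interval from \<open>rs\<close> to $s$. It is less
  than $1$ exactly because $a_+(s) < s$ while $a_+$ fixes \<open>rs\<close>. The fixed point plays the part of
  the inner point in the integral Lipschitz estimate, and any point of the larger ball the outer one.
\<close>

lemma contraction_towards_fixpoint:
  assumes s: "rs < s" "s \<le> R" "a_p s < s" and x: "norm (x - x0) \<le> s"
  shows "(\<lambda>n. (A ^^ n) x) \<longlonglongrightarrow> layer_fixpoint A x0 R k"
proof -
  let ?xs = "layer_fixpoint A x0 R k"
  define \<theta> where "\<theta> = (a_p s - rs) / (s - rs)"
  have \<theta>: "0 \<le> \<theta>" "\<theta> < 1"
    using s rs_range rs_fixpoint a_plus_mono[of rs s] by (auto simp: \<theta>_def)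
  have step: "norm (A y - ?xs) \<le> \<theta> * norm (y - ?xs)" if "y \<in> cball x0 s" for y
  proof -
    have "norm (A y - ?xs) * (s - rs) \<le> norm (y - ?xs) * (a_p s - rs)"
      using integral_lipschitz[of rs s ?xs y] a_plus_diff[of rs s] that s rs_range rs_fixpoint
        layer_fixpoint_in_ball layer_fixpoint_fixed by simp
    then show ?thesis using s by (simp add: \<theta>_def field_simps)
  qed
  have ball: "(A ^^ n) x \<in> cball x0 s" for n
    using orbit_bound[of s s x n] majorant_invariant[of s s n] s x rs_range
    by (auto simp: dist_norm norm_minus_commute)
  have geometric: "norm ((A ^^ n) x - ?xs) \<le> \<theta> ^ n * norm (x - ?xs)" for n
  proof (induction n)
    case (Suc n)
    have "norm ((A ^^ Suc n) x - ?xs) \<le> \<theta> * norm ((A ^^ n) x - ?xs)" using step ball by simp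
    also have "\<dots> \<le> \<theta> * (\<theta> ^ n * norm (x - ?xs))" using Suc \<theta> by (intro mult_left_mono)
    finally show ?case by (simp add: mult.assoc)
  qed simp
  have "(\<lambda>n. \<theta> ^ n * norm (x - ?xs)) \<longlonglongrightarrow> 0"
    using \<theta> by (intro tendsto_mult_left_zero LIMSEQ_realpow_zero)
  with geometric have "(\<lambda>n. (A ^^ n) x - ?xs) \<longlonglongrightarrow> 0"
    by (intro Lim_null_comparison[of "\<lambda>n. (A ^^ n) x - ?xs"]) auto
  then show ?thesis by (simp add: LIM_zero_iff)
qed

lemma orbit_tendsto_fixpoint:
  assumes "x \<in> cball x0 rs \<union> outer_layer A x0 R k"
  shows "(\<lambda>n. (A ^^ n) x) \<longlonglongrightarrow> layer_fixpoint A x0 R k"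
proof (cases "x \<in> cball x0 rs")
  case True
  then show ?thesis
    using tendsto_add[OF orbits_merge_in_inner_ball layer_fixpoint_limit] by simp
next
  case False
  then show ?thesis using assms outer_layer_radius contraction_towards_fixpoint by blast
qed

lemma admissible_start_radius:
  assumes "x \<in> cball x0 rs \<union> outer_layer A x0 R k"
  obtains M where "norm (x - x0) \<le> M" "M \<le> R" "a_p M \<le> M"
proof (cases "x \<in> cball x0 rs")
  case True
  then show ?thesis using that[of rs] rs_range rs_fixpoint by (simp add: dist_norm norm_minus_commute)
next
  case False
  then show ?thesis using assms outer_layer_radius that by (metis UnE less_imp_le)
qed

end

section \<open>Error estimates for the successive approximations\<close>

theorem theorem2:
  fixes A :: "'a::banach \<Rightarrow> 'a" and x0 :: 'a and R :: real and k :: "real \<Rightarrow> real"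
    and \<xi> :: "nat \<Rightarrow> 'a" and r \<rho> :: "nat \<Rightarrow> real"
  assumes "R > 0"
    and "\<And>t. t \<in> {0..R} \<Longrightarrow> k t \<ge> 0"
    and "k integrable_on {0..R}"
    and "variable_lipschitz A x0 R k"
    and "\<exists>t\<in>{0..R}. a_plus A x0 k t = t"
    and "\<exists>t\<in>{0..R}. a_minus A x0 k t = t"
    and "\<xi> 0 \<in> cball x0 (r_upper A x0 R k) \<union> outer_layer A x0 R k"
    and "\<And>n. \<xi> (Suc n) = A (\<xi> n)"
    and "r 0 = 0" and "\<And>n. r (Suc n) = a_plus A x0 k (r n)"
    and "\<rho> 0 = norm (\<xi> 0 - x0)" and "\<And>n. \<rho> (Suc n) = a_plus A x0 k (\<rho> n)"
  shows "(\<forall>n. \<xi> n \<in> cball x0 R) \<and> \<xi> \<longlonglongrightarrow> layer_fixpoint A x0 R k \<and>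
    (\<forall>n. r n \<in> {0..R} \<and> \<rho> n \<in> {0..R} \<and>
       norm (layer_fixpoint A x0 R k - \<xi> n) \<le> r_upper A x0 R k + \<rho> n - 2 * r n \<and>
       norm (\<xi> (Suc n) - \<xi> n) \<le> \<rho> (Suc n) + \<rho> n - 2 * r n)"
proof -
  interpret majorized_operator A x0 R k
    using assms(1-6) by unfold_locales auto
  let ?xs = "layer_fixpoint A x0 R k" and ?x = "\<lambda>n. (A ^^ n) x0"
  have \<xi>: "\<xi> n = (A ^^ n) (\<xi> 0)" for n by (induction n) (simp_all add: assms(8))
  have r: "r n = (a_p ^^ n) 0" for n by (induction n) (simp_all add: assms(9,10))
  have \<rho>: "\<rho> n = (a_p ^^ n) (norm (\<xi> 0 - x0))" for n by (induction n) (simp_all add: assms(11,12))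
  obtain M where M: "norm (\<xi> 0 - x0) \<le> M" "M \<le> R" "a_p M \<le> M"
    using admissible_start_radius[OF assms(7)] by blast
  have r_range: "r n \<in> {0..R}" for n using majorant_iterates_below[of n] rs_range by (auto simp: r)
  have \<rho>_range: "\<rho> n \<in> {0..R}" for n
    using majorant_invariant[of "norm (\<xi> 0 - x0)" M n] M by (auto simp: \<rho>)
  have ball: "\<xi> n \<in> cball x0 R" for n
    using orbit_bound[of "norm (\<xi> 0 - x0)" M "\<xi> 0" n] M \<rho>_range[of n]
    unfolding \<xi>[of n, symmetric] \<rho>[symmetric] by (auto simp: dist_norm norm_minus_commute)
  have lim: "\<xi> \<longlonglongrightarrow> ?xs"
    using orbit_tendsto_fixpoint[OF assms(7)] unfolding \<xi>[symmetric] .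
  have near: "norm (\<xi> n - ?x n) \<le> \<rho> n - r n" for n
    using compare_with_base_orbit[OF M, of n] unfolding \<xi>[of n, symmetric] r[symmetric] \<rho>[symmetric] .
  have est1: "norm (?xs - \<xi> n) \<le> rs + \<rho> n - 2 * r n" for n
  proof -
    have "norm (?xs - \<xi> n) \<le> norm (?xs - ?x n) + norm (\<xi> n - ?x n)"
      using norm_triangle_ineq4[of "?xs - ?x n" "\<xi> n - ?x n"] by simp
    then show ?thesis using layer_fixpoint_error[of n] near[of n] by (simp add: r)
  qed
  have est2: "norm (\<xi> (Suc n) - \<xi> n) \<le> \<rho> (Suc n) + \<rho> n - 2 * r n" for n
  proof -
    have "norm (?x (Suc n) - ?x n) \<le> r (Suc n) - r n"
      using base_orbit_increment[of n 1] by (simp add: r)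
    moreover have "norm (\<xi> (Suc n) - \<xi> n)
        \<le> norm (\<xi> (Suc n) - ?x (Suc n)) + norm (?x (Suc n) - ?x n) + norm (\<xi> n - ?x n)"
      using norm_triangle_ineq4[of "\<xi> (Suc n) - ?x n" "\<xi> n - ?x n"]
        norm_triangle_ineq[of "\<xi> (Suc n) - ?x (Suc n)" "?x (Suc n) - ?x n"] by simp
    ultimately show ?thesis using near[of n] near[of "Suc n"] by linarith
  qed
  show ?thesis using ball lim r_range \<rho>_range est1 est2 by blast
qed

end
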